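(* Let $f$ be any knot in the thickened torus $S^1\times S^1\times I$. Then $\mu_1=\lambda_2$ and $\lambda_1=\mu_2$ generate a copy of $\mathbb Z^2$ that splits as a direct factor of $\pi_1(\mathcal V_f)$.
   Context: $\mathcal V_f$ is the path component of $f$ in the space $\mathrm{Emb}(S^1,S^1\times S^1\times I)$ of smooth embeddings ($C^\infty$ topology). Identify $S^1\times S^1\times I$ with a standard neighborhood of the Clifford torus in $S^3$; $f$ corresponds to a 3-component link $(f_0,f_1,f_2)$ in $S^3$, where $f_0$ is the composite of the knot with the inclusion in $S^3$ and $(f_1,f_2)$ is the Hopf link formed by the core circles of the two complementary solid tori. The classes $\mu_i$ and $\lambda_i$ ($i=1,2$) correspond to the meridional and longitudinal rotations of a tubular neighborhood of $f_i$; in $\pi_1(\mathcal V_f)$, the two elements $\mu_1=\lambda_2$ and $\lambda_1=\mu_2$ are the classes of the two loops $t\mapsto R_t\circ f$, where $R_t$ is rotation by $e^{2\pi it}$, $t\in[0,1]$, of one of the two $S^1$ factors of $S^1\times S^1\times I$. *)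

theory Defs
  imports "HOL-Analysis.Analysis" "HOL-Algebra.Elementary_Groups"
begin

section \<open>The fundamental group of an abstract topological space\<close>

definition based_loops :: "'a topology \<Rightarrow> 'a \<Rightarrow> (real \<Rightarrow> 'a) set" where
  "based_loops X p = {g. pathin X g \<and> g 0 = p \<and> g 1 = p}"

definition loop_homotopy :: "'a topology \<Rightarrow> 'a \<Rightarrow> ((real \<Rightarrow> 'a) \<times> (real \<Rightarrow> 'a)) set" where
  "loop_homotopy X p =
     {(g, h). homotopic_with (\<lambda>r. r 0 = p \<and> r 1 = p) (top_of_set {0..1}) X g h}"

abbreviation loop_class :: "'a topology \<Rightarrow> 'a \<Rightarrow> (real \<Rightarrow> 'a) \<Rightarrow> (real \<Rightarrow> 'a) set" where
  "loop_class X p g \<equiv> loop_homotopy X p `` {g}"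

(* The sort constraint is only there to reuse the formula of path concatenation from the
   library; continuity of loops and homotopies is with respect to X. *)
definition fundamental_group ::
    "'a::topological_space topology \<Rightarrow> 'a \<Rightarrow> (real \<Rightarrow> 'a) set monoid" where
  "fundamental_group X p =
     \<lparr>carrier = based_loops X p // loop_homotopy X p,
      monoid.mult = (\<lambda>A B. \<Union>a\<in>A. \<Union>b\<in>B. loop_class X p (a +++ b)),
      one = loop_class X p (\<lambda>_. p)\<rparr>"


section \<open>The space of smooth embeddings of the circle in the thickened torus\<close>

abbreviation circle :: "complex set" where
  "circle \<equiv> sphere 0 1"

abbreviation thickened_torus :: "(complex \<times> complex \<times> real) set" where
  "thickened_torus \<equiv> circle \<times> circle \<times> {0..1}"

(* The k-th derivative of f in the angular coordinate of the circle, that is, of the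
   composite of f with the covering t |-> exp (i t). *)
definition circle_deriv ::
    "nat \<Rightarrow> (complex \<Rightarrow> complex \<times> complex \<times> real) \<Rightarrow> real \<Rightarrow> complex \<times> complex \<times> real" where
  "circle_deriv k f = ((\<lambda>F t. vector_derivative F (at t)) ^^ k) (\<lambda>t. f (cis t))"

(* Values outside the circle are fixed (extensional functions), so that an element of this set
   is exactly a map from the circle.  A map into the thickened torus, a submanifold with
   boundary of Euclidean space, is smooth iff it is smooth into the Euclidean space.
   An embedding may meet the boundary. *)
definition smooth_embeddings :: "(complex \<Rightarrow> complex \<times> complex \<times> real) set" where
  "smooth_embeddings =
     {f \<in> circle \<rightarrow>\<^sub>E thickened_torus.
        (\<forall>k t. circle_deriv k f differentiable (at t)) \<and>
        (\<forall>t. circle_deriv 1 f t \<noteq> 0) \<and>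
        embedding_map (top_of_set circle) (top_of_set thickened_torus) f}"

(* The C-infinity topology: uniform convergence of every derivative (the circle is compact). *)
definition Emb :: "(complex \<Rightarrow> complex \<times> complex \<times> real) topology" where
  "Emb = topology_generated_by
     {{g \<in> smooth_embeddings. \<forall>t. dist (circle_deriv k g t) (circle_deriv k f t) < \<epsilon>} | f k \<epsilon>.
        f \<in> smooth_embeddings \<and> 0 < \<epsilon>}"

lemma topspace_Emb: "topspace Emb = smooth_embeddings"
proof
  show "topspace Emb \<subseteq> smooth_embeddings"
    by (auto simp: Emb_def topology_generated_by_topspace)
  show "smooth_embeddings \<subseteq> topspace Emb"
  proof
    fix f assume f: "f \<in> smooth_embeddings"
    let ?U = "{g \<in> smooth_embeddings. \<forall>t. dist (circle_deriv 0 g t) (circle_deriv 0 f t) < 1}"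
    have "f \<in> ?U" using f by simp
    moreover have "openin Emb ?U"
      unfolding Emb_def by (rule topology_generated_by_Basis) (use f zero_less_one in blast)
    ultimately show "f \<in> topspace Emb" using openin_subset by blast
  qed
qed

definition knot_component ::
    "(complex \<Rightarrow> complex \<times> complex \<times> real) \<Rightarrow> (complex \<Rightarrow> complex \<times> complex \<times> real) topology" where
  "knot_component f = subtopology Emb (path_component_of_set Emb f)"


section \<open>The two rotation classes\<close>

definition rotate_first :: "real \<Rightarrow> complex \<times> complex \<times> real \<Rightarrow> complex \<times> complex \<times> real" where
  "rotate_first t = (\<lambda>(z, w, s). (cis (2 * pi * t) * z, w, s))"

definition rotate_second :: "real \<Rightarrow> complex \<times> complex \<times> real \<Rightarrow> complex \<times> complex \<times> real" where
  "rotate_second t = (\<lambda>(z, w, s). (z, cis (2 * pi * t) * w, s))"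

(* Write the 3-sphere as the unit sphere of C^2, with the thickened torus around the Clifford
   torus, and the Hopf link as f1 = {(u, 0)}, f2 = {(0, v)}.  Rotating u (the first circle factor)
   is the longitudinal rotation about f1 and the meridional rotation about f2; rotating v is the
   meridional rotation about f1 and the longitudinal rotation about f2.  Hence
   lambda1 = mu2 and mu1 = lambda2 as classes of loops. *)
definition lambda1_mu2 ::
    "(complex \<Rightarrow> complex \<times> complex \<times> real) \<Rightarrow> (real \<Rightarrow> complex \<Rightarrow> complex \<times> complex \<times> real) set" where
  "lambda1_mu2 f = loop_class (knot_component f) f (\<lambda>t. compose circle (rotate_first t) f)"

definition mu1_lambda2 ::
    "(complex \<Rightarrow> complex \<times> complex \<times> real) \<Rightarrow> (real \<Rightarrow> complex \<Rightarrow> complex \<times> complex \<times> real) set" where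
  "mu1_lambda2 f = loop_class (knot_component f) f (\<lambda>t. compose circle (rotate_second t) f)"

end

theory Submission
  imports Defs "HOL-Complex_Analysis.Winding_Numbers"
begin

text \<open>
  The torus acts on the component of \<open>f\<close> by rotating the two circle factors, so the classes of the
  two rotation loops are central. Evaluating a knot at the point \<open>1\<close> of the circle and projecting to
  the torus is equivariant, hence the winding numbers of the two coordinates of the evaluation
  define a homomorphism from the fundamental group to \<open>\<int>\<^sup>2\<close> which sends the two classes to the standard
  basis. Therefore the two classes freely generate a central \<open>\<int>\<^sup>2\<close>, and the kernel is a complement.
\<close>

section \<open>Splitting off central elements\<close>

text \<open>The orbit map of the torus followed by evaluation and projection is translation by the
  projection of \<open>f 1\<close>, so the fundamental group of the torus is a retract of that of
  the component. A retract alone yields a semidirect product with the kernel; centrality makes the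
  product direct. The analytic obstacle is joint continuity of the action in the C-infinity
  topology: rotations are real-linear isometries of the ambient Euclidean space, so they commute
  with angular derivatives of every order, and compactness of the circle turns pointwise estimates
  into uniform ones.\<close>

lemma (in group) int_pow_commute:
  assumes a: "a \<in> carrier G" and x: "x \<in> carrier G" and ax: "a \<otimes> x = x \<otimes> a"
  shows "(a [^] (i::int)) \<otimes> x = x \<otimes> (a [^] i)"
proof -
  have nat: "(a [^] (n::nat)) \<otimes> x = x \<otimes> (a [^] n)" for n
    using pow_mult_distrib[OF ax a x] group_commutes_pow[OF ax a x] by simp
  \<comment> \<open>A negative power is the inverse of a natural power, so it suffices that
    commuting with \<open>x\<close> passes to inverses.\<close>
  have inv: "inv y \<otimes> x = x \<otimes> inv y" if y: "y \<in> carrier G" and yx: "y \<otimes> x = x \<otimes> y" for y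
  proof -
    have "inv y \<otimes> x = inv y \<otimes> (x \<otimes> (y \<otimes> inv y))" using x y by simp
    also have "\<dots> = inv y \<otimes> ((y \<otimes> x) \<otimes> inv y)" using x y by (simp add: yx m_assoc)
    also have "\<dots> = (inv y \<otimes> y) \<otimes> (x \<otimes> inv y)"
      using x y m_assoc[of "inv y" y "x \<otimes> inv y"] m_assoc[of y x "inv y"] by simp
    finally show ?thesis using x y by simp
  qed
  show ?thesis
    unfolding int_pow_def2 using nat[of "nat i"] inv[OF nat_pow_closed[OF a] nat[of "nat (- i)"]]
    by (cases "i < 0") (simp_all only: if_True if_False)
qed

text \<open>The pair \<open>(m, n)\<close> detects exponents, so there are no relations between
  \<open>a\<close> and \<open>b\<close> beyond commutativity, and sending \<open>x\<close> to
  \<open>a [^] m x \<otimes> b [^] n x\<close> retracts the group onto the subgroup they generate.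
  Correcting \<open>x\<close> by its retraction leaves an element of the common kernel of
  \<open>m\<close> and \<open>n\<close>.\<close>

lemma (in group) central_direct_factor:
  assumes a: "a \<in> carrier G" and b: "b \<in> carrier G"
    and ca: "\<And>x. x \<in> carrier G \<Longrightarrow> a \<otimes> x = x \<otimes> a"
    and cb: "\<And>x. x \<in> carrier G \<Longrightarrow> b \<otimes> x = x \<otimes> b"
    and m: "m \<in> hom G integer_group" and n: "n \<in> hom G integer_group"
    and mn: "m a = 1" "m b = 0" "n a = 0" "n b = 1"
  defines "H \<equiv> generate G {a, b}"
  shows "subgroup H G \<and>
    subgroup_generated G H \<cong> integer_group \<times>\<times> integer_group \<and>
    (\<exists>K. subgroup K G \<and>
      (\<lambda>(x, y). x \<otimes> y) \<in> iso (subgroup_generated G H \<times>\<times> subgroup_generated G K) G)"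
proof -
  interpret m: group_hom G integer_group m
    using m by (simp add: group_hom_def group_hom_axioms_def is_group)
  interpret n: group_hom G integer_group n
    using n by (simp add: group_hom_def group_hom_axioms_def is_group)
  define f where "f = (\<lambda>(i::int, j::int). (a [^] i) \<otimes> (b [^] j))"
  have fc: "f z \<in> carrier G" for z using a b by (auto simp: f_def split: prod.split)
  have cai: "(a [^] (i::int)) \<otimes> x = x \<otimes> (a [^] i)" if "x \<in> carrier G" for x i
    using int_pow_commute[OF a that ca[OF that]] .
  have cbi: "(b [^] (i::int)) \<otimes> x = x \<otimes> (b [^] i)" if "x \<in> carrier G" for x i
    using int_pow_commute[OF b that cb[OF that]] .
  have cf: "f z \<otimes> x = x \<otimes> f z" if "x \<in> carrier G" for x z
  proof -
    obtain i j where z: "z = (i, j)" by (cases z)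
    have "f z \<otimes> x = (a [^] i) \<otimes> ((b [^] j) \<otimes> x)"
      using that a b by (simp add: z f_def m_assoc)
    also have "\<dots> = ((a [^] i) \<otimes> x) \<otimes> (b [^] j)"
      unfolding cbi[OF that] using that a b by (simp add: m_assoc)
    also have "\<dots> = (x \<otimes> (a [^] i)) \<otimes> (b [^] j)"
      by (subst cai[OF that]) (rule refl)
    also have "\<dots> = x \<otimes> f z"
      using that a b by (simp add: z f_def m_assoc)
    finally show ?thesis .
  qed
  have fadd: "f (i, j) \<otimes> f (k, l) = f (i + k, j + l)" for i j k l
  proof -
    have "f (i, j) \<otimes> f (k, l) = (a [^] i) \<otimes> ((b [^] j) \<otimes> (a [^] k)) \<otimes> (b [^] l)"
      using a b by (simp add: f_def m_assoc)
    also have "\<dots> = (a [^] i) \<otimes> ((a [^] k) \<otimes> (b [^] j)) \<otimes> (b [^] l)"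
      using cbi[of "a [^] k" j] a by simp
    also have "\<dots> = f (i + k, j + l)"
      using a b by (simp add: f_def m_assoc int_pow_mult)
    finally show ?thesis .
  qed
  have fhom: "f \<in> hom (integer_group \<times>\<times> integer_group) G"
    by (auto simp: hom_def fc fadd)
  interpret f: group_hom "integer_group \<times>\<times> integer_group" G f
    using fhom by (simp add: group_hom_def group_hom_axioms_def DirProd_group is_group)
  have mf: "m (f (i, j)) = i" and nf: "n (f (i, j)) = j" for i j
    using a b by (simp_all add: f_def mn m.hom_int_pow n.hom_int_pow)
  have H: "subgroup H G"
    unfolding H_def using a b by (intro generate_is_subgroup) auto
  interpret H: subgroup H G by fact
  have R: "subgroup (range f) G"
    using f.img_is_subgroup by simp
  have fa: "f (1, 0) = a" "f (0, 1) = b" using a b by (auto simp: f_def)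
  have HR: "H = range f"
  proof
    show "H \<subseteq> range f"
      unfolding H_def by (intro generate_subgroup_incl R) (auto simp flip: fa)
    have "a \<in> H" "b \<in> H" unfolding H_def by (auto intro: generate.incl)
    then show "range f \<subseteq> H"
      by (auto simp: f_def intro!: H.m_closed subgroup_int_pow_closed[OF H])
  qed
  define K where "K = {x \<in> carrier G. m x = 0 \<and> n x = 0}"
  have K: "subgroup K G"
    by (rule subgroupI) (auto simp: K_def intro!: exI[of _ \<one>])
  interpret K: subgroup K G by fact
  have cH: "carrier (subgroup_generated G H) = H" and cK: "carrier (subgroup_generated G K) = K"
    by simp_all
  have "f \<in> iso (integer_group \<times>\<times> integer_group) (subgroup_generated G H)"
  proof -
    have "inj f" by (rule inj_on_inverseI[where g = "\<lambda>x. (m x, n x)"]) (auto simp: mf nf)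
    then show ?thesis
      using fhom HR unfolding iso_def bij_betw_def hom_def cH by auto
  qed
  then have 1: "subgroup_generated G H \<cong> integer_group \<times>\<times> integer_group"
    using group.iso_sym[OF DirProd_group[OF group_integer_group group_integer_group]] is_isoI by blast
  have "(\<lambda>(x, y). x \<otimes> y) \<in> hom (subgroup_generated G H \<times>\<times> subgroup_generated G K) G"
  proof -
    \<comment> \<open>Only the middle factors must be exchanged, and \<open>x'\<close> is central
      because it is a value of \<open>f\<close>.\<close>
    have "x \<otimes> x' \<otimes> (y \<otimes> y') = x \<otimes> y \<otimes> (x' \<otimes> y')"
      if xy: "x \<in> H" "y \<in> K" "x' \<in> H" "y' \<in> K" for x y x' y'
    proof -
      have c: "x \<in> carrier G" "y \<in> carrier G" "x' \<in> carrier G" "y' \<in> carrier G"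
        using xy by (simp_all add: H.mem_carrier K.mem_carrier)
      obtain z where z: "x' = f z" using xy(3) unfolding HR by blast
      have "x \<otimes> x' \<otimes> (y \<otimes> y') = x \<otimes> (x' \<otimes> y) \<otimes> y'"
        using c by (simp add: m_assoc)
      also have "\<dots> = x \<otimes> (y \<otimes> x') \<otimes> y'"
        using cf[of y z] c z by simp
      finally show ?thesis using c by (simp add: m_assoc)
    qed
    then show ?thesis
      using H.mem_carrier K.mem_carrier unfolding hom_def carrier_DirProd cH cK by auto
  qed
  moreover have "bij_betw (\<lambda>(x, y). x \<otimes> y) (H \<times> K) (carrier G)"
  proof (rule bij_betw_byWitness[where f' = "\<lambda>x. (f (m x, n x), inv (f (m x, n x)) \<otimes> x)"])
    have inv_l: "inv (f z) \<otimes> (f z \<otimes> x) = x" and inv_r: "f z \<otimes> (inv (f z) \<otimes> x) = x"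
      if "x \<in> carrier G" for z x
      using that fc[of z] m_assoc[of "inv (f z)" "f z" x] m_assoc[of "f z" "inv (f z)" x]
      by simp_all
    have "(\<lambda>x. (f (m x, n x), inv (f (m x, n x)) \<otimes> x)) (h \<otimes> y) = (h, y)"
      if hy: "h \<in> H" "y \<in> K" for h y
    proof -
      obtain w where w: "h = f w" using hy(1) unfolding HR by blast
      obtain i j where "w = (i, j)" by (cases w)
      with w have h: "h = f (i, j)" by simp
      have y: "y \<in> carrier G" "m y = 0" "n y = 0" using hy(2) unfolding K_def by blast+
      have "m (h \<otimes> y) = i" "n (h \<otimes> y) = j"
        using y fc[of "(i, j)"] by (simp_all add: h mf nf)
      then show ?thesis using inv_l[OF y(1)] by (simp add: h)
    qed
    then show "\<forall>z\<in>H \<times> K. (\<lambda>x. (f (m x, n x), inv (f (m x, n x)) \<otimes> x)) ((\<lambda>(x, y). x \<otimes> y) z) = z"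
      by (intro ballI; elim SigmaE; simp only: case_prod_conv)
    show "\<forall>x\<in>carrier G. (\<lambda>(x, y). x \<otimes> y) (f (m x, n x), inv (f (m x, n x)) \<otimes> x) = x"
      using inv_r by simp
    have "inv (f (m x, n x)) \<otimes> x \<in> K" if "x \<in> carrier G" for x
    proof -
      let ?y = "inv (f (m x, n x)) \<otimes> x"
      have "?y \<in> carrier G" "m ?y = 0" "n ?y = 0" using that fc by (simp_all add: mf nf)
      then show ?thesis unfolding K_def by blast
    qed
    then show "(\<lambda>x. (f (m x, n x), inv (f (m x, n x)) \<otimes> x)) ` carrier G \<subseteq> H \<times> K"
      unfolding HR by blast
    show "(\<lambda>(x, y). x \<otimes> y) ` (H \<times> K) \<subseteq> carrier G"
      using H.mem_carrier K.mem_carrier by auto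
  qed
  ultimately have "(\<lambda>(x, y). x \<otimes> y) \<in> iso (subgroup_generated G H \<times>\<times> subgroup_generated G K) G"
    by (simp add: iso_def cH cK)
  then show ?thesis by (intro conjI exI[of _ K] H 1 K)
qed

section \<open>The fundamental group\<close>

lemma equiv_loop_homotopy: "equiv (based_loops X p) (loop_homotopy X p)"
proof (rule equivI)
  show "loop_homotopy X p \<subseteq> based_loops X p \<times> based_loops X p"
    by (auto simp: loop_homotopy_def based_loops_def pathin_def
        dest: homotopic_with_imp_continuous_maps homotopic_with_imp_property)
  show "refl_on (based_loops X p) (loop_homotopy X p)"
    by (auto simp: refl_on_def loop_homotopy_def based_loops_def pathin_def)
  show "sym (loop_homotopy X p)"
    by (auto simp: sym_def loop_homotopy_def intro: homotopic_with_symD)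
  show "trans (loop_homotopy X p)"
    by (auto simp: trans_def loop_homotopy_def intro: homotopic_with_trans)
qed

lemma loop_class_eqI: "(g, h) \<in> loop_homotopy X p \<Longrightarrow> loop_class X p g = loop_class X p h"
  by (rule equiv_class_eq[OF equiv_loop_homotopy])

text \<open>With a convex domain \<open>Q\<close> of parameters, the straight-line homotopy in \<open>Q\<close> yields all
  homotopies needed below: for \<open>Q = [0,1]\<close> the reparametrisations in the group axioms, and for the square
  the commutation of loops.\<close>
lemma loop_homotopy_convexI:
  fixes u v :: "real \<Rightarrow> 'b::real_normed_vector"
  assumes Q: "convex Q" and S: "continuous_map (top_of_set Q) X S"
    and u: "continuous_on {0..1} u" "u \<in> {0..1} \<rightarrow> Q"
    and v: "continuous_on {0..1} v" "v \<in> {0..1} \<rightarrow> Q"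
    and ends: "u 0 = v 0" "u 1 = v 1" "S (u 0) = p" "S (u 1) = p"
    and gh: "\<And>t. t \<in> {0..1} \<Longrightarrow> g t = S (u t)" "\<And>t. t \<in> {0..1} \<Longrightarrow> h t = S (v t)"
  shows "(g, h) \<in> loop_homotopy X p"
proof -
  let ?P = "\<lambda>r. r (0::real) = p \<and> r (1::real) = p"
  let ?I = "top_of_set {0..1::real}"
  have "homotopic_with ?P ?I X (S \<circ> u) (S \<circ> v)"
    unfolding homotopic_with_def
  proof (intro exI[of _ "\<lambda>(s, t). S ((1 - s) *\<^sub>R u t + s *\<^sub>R v t)"] conjI allI ballI)
    have "continuous_map (top_of_set ({0..1} \<times> {0..1})) (top_of_set Q)
            (\<lambda>z. (1 - fst z) *\<^sub>R u (snd z) + fst z *\<^sub>R v (snd z))"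
      using Q u(2) v(2)
      by (auto simp: Pi_iff intro!: continuous_intros continuous_on_compose2[OF u(1)]
          continuous_on_compose2[OF v(1)] convexD)
    from continuous_map_compose[OF this S]
    show "continuous_map (prod_topology ?I ?I) X (\<lambda>(s, t). S ((1 - s) *\<^sub>R u t + s *\<^sub>R v t))"
      by (simp add: o_def case_prod_unfold)
  qed (use ends in \<open>auto simp flip: scaleR_left_distrib\<close>)
  \<comment> \<open>\<open>homotopic_with\<close> fixes the end functions on the whole real line,
    while \<open>g\<close> and \<open>h\<close> are known only on the unit interval; these two
    homotopies bridge the difference.\<close>
  moreover have "homotopic_with ?P ?I X g (S \<circ> u)" "homotopic_with ?P ?I X (S \<circ> v) h"
  proof -
    have "continuous_map ?I X (S \<circ> u)" "continuous_map ?I X (S \<circ> v)"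
      using u v by (auto intro!: continuous_map_compose[OF _ S] simp: image_subset_iff_funcset)
    then have "homotopic_with ?P ?I X (S \<circ> u) g" "homotopic_with ?P ?I X (S \<circ> v) h"
      using ends gh[of 0] gh[of 1] by (auto intro!: homotopic_with_equal simp: gh)
    then show "homotopic_with ?P ?I X g (S \<circ> u)" "homotopic_with ?P ?I X (S \<circ> v) h"
      by (auto intro: homotopic_with_symD)
  qed
  ultimately show ?thesis
    unfolding loop_homotopy_def by (auto intro: homotopic_with_trans)
qed

text \<open>The homotopies are run side by side in the loop variable. They glue along the middle
  line because every intermediate curve is itself a loop at \<open>p\<close>.\<close>

lemma loop_homotopy_join:
  assumes a: "(a, a') \<in> loop_homotopy X p" and b: "(b, b') \<in> loop_homotopy X p"
  shows "(a +++ b, a' +++ b') \<in> loop_homotopy X p"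
proof -
  let ?I = "top_of_set {0..1::real}"
  from a obtain h where h: "continuous_map (prod_topology ?I ?I) X h" "\<And>x. h (0, x) = a x"
    "\<And>x. h (1, x) = a' x" "\<And>t. t \<in> {0..1} \<Longrightarrow> h (t, 0) = p \<and> h (t, 1) = p"
    by (auto simp: loop_homotopy_def homotopic_with_def)
  from b obtain k where k: "continuous_map (prod_topology ?I ?I) X k" "\<And>x. k (0, x) = b x"
    "\<And>x. k (1, x) = b' x" "\<And>t. t \<in> {0..1} \<Longrightarrow> k (t, 0) = p \<and> k (t, 1) = p"
    by (auto simp: loop_homotopy_def homotopic_with_def)
  define H where "H = (\<lambda>z. if snd z \<le> 1/2 then h (fst z, 2 * snd z) else k (fst z, 2 * snd z - 1))"
  have "continuous_map (prod_topology ?I ?I) X H"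
    unfolding H_def
  proof (rule continuous_map_cases_le)
    have *: "prod_topology ?I ?I = top_of_set ({0..1} \<times> {0..1})" by simp
    have "continuous_map (top_of_set (({0..1} \<times> {0..1}) \<inter> {z. snd z \<le> 1/2})) (prod_topology ?I ?I)
        (\<lambda>z. (fst z, 2 * snd z))"
      by (auto intro!: continuous_intros)
    from continuous_map_compose[OF this h(1)]
    show "continuous_map (subtopology (prod_topology ?I ?I)
        {z \<in> topspace (prod_topology ?I ?I). snd z \<le> 1/2}) X (\<lambda>z. h (fst z, 2 * snd z))"
      by (simp add: * subtopology_subtopology o_def Collect_conj_eq Int_assoc[symmetric])
    have "continuous_map (top_of_set (({0..1} \<times> {0..1}) \<inter> {z. 1/2 \<le> snd z})) (prod_topology ?I ?I)
        (\<lambda>z. (fst z, 2 * snd z - 1))"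
      by (auto intro!: continuous_intros)
    from continuous_map_compose[OF this k(1)]
    show "continuous_map (subtopology (prod_topology ?I ?I)
        {z \<in> topspace (prod_topology ?I ?I). 1/2 \<le> snd z}) X (\<lambda>z. k (fst z, 2 * snd z - 1))"
      by (simp add: * subtopology_subtopology o_def Collect_conj_eq Int_assoc[symmetric])
    show "h (fst z, 2 * snd z) = k (fst z, 2 * snd z - 1)"
      if "z \<in> topspace (prod_topology ?I ?I)" "snd z = 1/2" for z
    proof -
      have "2 * snd z = 1" "2 * snd z - 1 = 0" "fst z \<in> {0..1}" using that by auto
      then show ?thesis using h(4)[of "fst z"] k(4)[of "fst z"] by metis
    qed
    show "continuous_map (prod_topology ?I ?I) euclideanreal snd"
      by (simp add: continuous_on_snd)
  qed simp
  then show ?thesis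
    using h k unfolding loop_homotopy_def homotopic_with_def
    by (auto intro!: exI[of _ H] simp: H_def joinpaths_def)
qed

text \<open>A curve is a based loop exactly when it is related to itself, so this is the reflexive
  case of the previous lemma.\<close>

lemma based_loops_join:
  assumes "a \<in> based_loops X p" "b \<in> based_loops X p"
  shows "a +++ b \<in> based_loops X p"
  using loop_homotopy_join[of a a X p b b] assms equiv_loop_homotopy[of X p]
  by (auto simp: equiv_class_eq_iff)

lemma carrier_fundamental_group:
  "carrier (fundamental_group X p) = based_loops X p // loop_homotopy X p"
  by (simp add: fundamental_group_def)

lemma one_fundamental_group: "\<one>\<^bsub>fundamental_group X p\<^esub> = loop_class X p (\<lambda>_. p)"
  by (simp add: fundamental_group_def)

text \<open>The product is defined as a union over all representatives; compatibility of
  \<open>+++\<close> with homotopy collapses it to a single class, so that later arguments can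
  compute with chosen loops.\<close>

lemma mult_fundamental_group:
  assumes "a \<in> based_loops X p" "b \<in> based_loops X p"
  shows "loop_class X p a \<otimes>\<^bsub>fundamental_group X p\<^esub> loop_class X p b = loop_class X p (a +++ b)"
proof -
  have "congruent2 (loop_homotopy X p) (loop_homotopy X p) (\<lambda>a b. loop_class X p (a +++ b))"
    by (intro congruent2I' loop_class_eqI loop_homotopy_join)
  from UN_equiv_class2[OF equiv_loop_homotopy equiv_loop_homotopy this assms]
  show ?thesis by (simp add: fundamental_group_def)
qed

lemma based_loopsD:
  assumes "a \<in> based_loops X p"
  shows "continuous_map (top_of_set {0..1}) X a" "a 0 = p" "a 1 = p"
  using assms by (auto simp: based_loops_def pathin_def)

lemma group_fundamental_group:
  assumes "p \<in> topspace X"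
  shows "group (fundamental_group X p)"
proof (rule groupI; unfold carrier_fundamental_group one_fundamental_group)
  let ?G = "fundamental_group X p" and ?L = "based_loops X p" and ?R = "loop_homotopy X p"
  have c: "(\<lambda>_. p) \<in> ?L" using assms by (simp add: based_loops_def pathin_def)
  show "loop_class X p (\<lambda>_. p) \<in> ?L // ?R" by (rule quotientI[OF c])
  fix A assume "A \<in> ?L // ?R"
  then obtain a where A: "A = loop_class X p a" and a: "a \<in> ?L" by (auto elim: quotientE)
  note a' = based_loopsD[OF a]
  have "((\<lambda>_. p) +++ a, a) \<in> ?R"
  proof (rule loop_homotopy_convexI[where Q = "{0..1}" and S = a and v = "\<lambda>t. t"])
    \<comment> \<open>Waiting at time 0 for the first half and then running at double speed
      reproduces the constant loop followed by \<open>a\<close>.\<close>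
    show "continuous_on {0..1} (\<lambda>t::real. max 0 (2 * t - 1))" by (intro continuous_intros)
  qed (use a' in \<open>auto simp: joinpaths_def max.absorb1 max.absorb2\<close>)
  then show "loop_class X p (\<lambda>_. p) \<otimes>\<^bsub>?G\<^esub> A = A"
    by (simp add: A a c mult_fundamental_group loop_class_eqI)
  have r: "reversepath a \<in> ?L"
    using a' continuous_map_compose[of "top_of_set {0..1}" "top_of_set {0..1::real}" "\<lambda>t. 1 - t" X a]
    by (auto simp: based_loops_def pathin_def reversepath_def o_def continuous_on_diff continuous_on_id)
  have "(reversepath a +++ a, (\<lambda>_. p)) \<in> ?R"
  proof (rule loop_homotopy_convexI[where Q = "{0..1}" and S = a and v = "\<lambda>t. 1"])
    \<comment> \<open>Time runs from 1 back to 0 and returns to 1; it is contracted to the constant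
      time 1, where \<open>a\<close> has the value \<open>p\<close>.\<close>
    show "continuous_on {0..1} (\<lambda>t::real. \<bar>1 - 2 * t\<bar>)" by (intro continuous_intros)
  qed (use a' in \<open>auto simp: joinpaths_def reversepath_def abs_le_iff abs_of_nonneg abs_of_nonpos\<close>)
  then show "\<exists>B\<in>?L // ?R. B \<otimes>\<^bsub>?G\<^esub> A = loop_class X p (\<lambda>_. p)"
    using r by (intro bexI[of _ "loop_class X p (reversepath a)"])
      (simp_all add: A a mult_fundamental_group loop_class_eqI quotientI)
  fix B assume "B \<in> ?L // ?R"
  then obtain b where B: "B = loop_class X p b" and b: "b \<in> ?L" by (auto elim: quotientE)
  show "A \<otimes>\<^bsub>?G\<^esub> B \<in> ?L // ?R"
    by (simp add: A B a b mult_fundamental_group quotientI based_loops_join)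
  fix C assume "C \<in> ?L // ?R"
  then obtain c where C: "C = loop_class X p c" and c: "c \<in> ?L" by (auto elim: quotientE)
  note b' = based_loopsD[OF b] and c' = based_loopsD[OF c]
  note abc = based_loopsD[OF based_loops_join[OF a based_loops_join[OF b c]]]
  have "((a +++ b) +++ c, a +++ (b +++ c)) \<in> ?R"
  proof (rule loop_homotopy_convexI[where Q = "{0..1}" and S = "a +++ (b +++ c)" and v = "\<lambda>t. t"])
    \<comment> \<open>The time change sends the breakpoints 1/4, 1/2 of the left bracketing to 1/2,
      3/4 of the right one. Its slopes 2, 1, 1/2 decrease, so it is concave and equals the minimum
      of its three linear pieces.\<close>
    show "continuous_on {0..1} (\<lambda>t::real. min (2 * t) (min (t + 1/4) (t / 2 + 1/2)))"
      by (intro continuous_intros) auto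
  qed (use abc in \<open>auto simp: joinpaths_def min_def algebra_simps\<close>)
  then show "A \<otimes>\<^bsub>?G\<^esub> B \<otimes>\<^bsub>?G\<^esub> C = A \<otimes>\<^bsub>?G\<^esub> (B \<otimes>\<^bsub>?G\<^esub> C)"
    by (simp add: A B C a b c mult_fundamental_group based_loops_join loop_class_eqI)
qed

text \<open>The two concatenations are the two boundary paths of the square \<open>(t, s) \<mapsto> R t (a s)\<close>.\<close>
lemma orbit_loop_central:
  assumes R: "continuous_map (prod_topology (top_of_set {0..1::real}) X) X (\<lambda>(t, x). R t x)"
    and R01: "\<And>x. x \<in> topspace X \<Longrightarrow> R 0 x = x" "\<And>x. x \<in> topspace X \<Longrightarrow> R 1 x = x"
    and p: "p \<in> topspace X" and A: "A \<in> carrier (fundamental_group X p)"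
  shows "(\<lambda>t. R t p) \<in> based_loops X p"
    and "loop_class X p (\<lambda>t. R t p) \<otimes>\<^bsub>fundamental_group X p\<^esub> A
       = A \<otimes>\<^bsub>fundamental_group X p\<^esub> loop_class X p (\<lambda>t. R t p)"
proof -
  let ?I = "top_of_set {0..1::real}"
  obtain a where A: "A = loop_class X p a" and a: "a \<in> based_loops X p"
    using A by (auto simp: carrier_fundamental_group elim: quotientE)
  note a' = based_loopsD[OF a]
  have "continuous_map ?I (prod_topology ?I X) (\<lambda>t. (t, p))"
    using p by (intro continuous_map_pairedI) auto
  from continuous_map_compose[OF this R] show r: "(\<lambda>t. R t p) \<in> based_loops X p"
    using p R01 by (auto simp: based_loops_def pathin_def o_def)
  have "continuous_map (prod_topology ?I ?I) (prod_topology ?I X) (\<lambda>(t, s). (t, a s))"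
    using a'(1) by (simp add: continuous_map_prod_top[of ?I ?I ?I X "\<lambda>t. t" a, simplified])
  from continuous_map_compose[OF this R]
  have S: "continuous_map (top_of_set ({0..1} \<times> {0..1})) X (\<lambda>(t, s). R t (a s))"
    by (simp add: o_def case_prod_unfold)
  have ta: "a t \<in> topspace X" if "0 \<le> t" "t \<le> 1" for t
    using a'(1) that by (auto simp: continuous_map_def)
  have "((\<lambda>t. R t p) +++ a, a +++ (\<lambda>t. R t p)) \<in> loop_homotopy X p"
  proof (rule loop_homotopy_convexI[OF _ S])
    \<comment> \<open>Each path runs one coordinate of the square from 0 to 1 while the other waits,
      then exchanges the roles. Both lead from \<open>(0, 0)\<close> to \<open>(1, 1)\<close>, and
      both corners are mapped to \<open>p\<close>.\<close>
    show "continuous_on {0..1} (\<lambda>t::real. (min (2 * t) 1, max 0 (2 * t - 1)))"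
      "continuous_on {0..1} (\<lambda>t::real. (max 0 (2 * t - 1), min (2 * t) 1))"
      by (intro continuous_intros)+
  qed (use a' p ta in \<open>auto intro!: convex_Times simp: joinpaths_def R01 max.absorb1 max.absorb2
        min.absorb1 min.absorb2\<close>)
  then show "loop_class X p (\<lambda>t. R t p) \<otimes>\<^bsub>fundamental_group X p\<^esub> A
       = A \<otimes>\<^bsub>fundamental_group X p\<^esub> loop_class X p (\<lambda>t. R t p)"
    by (simp add: A a r mult_fundamental_group loop_class_eqI)
qed

section \<open>Winding numbers as homomorphisms to the integers\<close>

text \<open>The chosen representative is irrelevant, and rounding does not change the value, which is already
  an integer.\<close>
definition winding_class :: "('a \<Rightarrow> complex) \<Rightarrow> (real \<Rightarrow> 'a) set \<Rightarrow> int" where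
  "winding_class c A = \<lfloor>Re (winding_number (c \<circ> (SOME g. g \<in> A)) 0)\<rfloor>"

text \<open>\<open>c\<close> carries a based homotopy to a homotopy of paths in the punctured plane,
  hence the independence of the choice; the image path is closed, hence the integrality.\<close>

lemma winding_class_loop_class:
  assumes c: "continuous_map X (top_of_set (- {0})) c" and g: "g \<in> based_loops X p"
  shows "of_int (winding_class c (loop_class X p g)) = winding_number (c \<circ> g) 0"
proof -
  define h where "h = (SOME h. h \<in> loop_class X p g)"
  have "g \<in> loop_class X p g" using equiv_class_self[OF equiv_loop_homotopy g] .
  then have "h \<in> loop_class X p g" unfolding h_def by (rule someI[where P = "\<lambda>h. h \<in> loop_class X p g"])
  then have "homotopic_paths (- {0}) (c \<circ> g) (c \<circ> h)"
    unfolding homotopic_paths_def loop_homotopy_def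
    using based_loopsD[OF g]
    by (auto simp: pathstart_def pathfinish_def intro!: homotopic_with_compose_continuous_map_left[OF _ c])
  then have "winding_number (c \<circ> g) 0 = winding_number (c \<circ> h) 0"
    by (rule winding_number_homotopic_paths)
  moreover have "path (c \<circ> g)" "0 \<notin> path_image (c \<circ> g)"
    using continuous_map_compose[OF based_loopsD(1)[OF g] c]
    by (auto simp: path_def path_image_def Pi_iff)
  then have "winding_number (c \<circ> g) 0 \<in> \<int>"
    using based_loopsD[OF g] by (intro integer_winding_number) (auto simp: pathstart_def pathfinish_def)
  ultimately show ?thesis
    unfolding winding_class_def h_def[symmetric] by (auto elim!: Ints_cases)
qed

lemma winding_class_hom:
  assumes c: "continuous_map X (top_of_set (- {0})) c"
  shows "winding_class c \<in> hom (fundamental_group X p) integer_group"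
proof (rule homI)
  fix A B assume "A \<in> carrier (fundamental_group X p)" "B \<in> carrier (fundamental_group X p)"
  then obtain a b where A: "A = loop_class X p a" "a \<in> based_loops X p"
    and B: "B = loop_class X p b" "b \<in> based_loops X p"
    by (auto simp: carrier_fundamental_group elim!: quotientE)
  have *: "path (c \<circ> g)" "0 \<notin> path_image (c \<circ> g)" if "g \<in> based_loops X p" for g
    using continuous_map_compose[OF based_loopsD(1)[OF that] c]
    by (auto simp: path_def path_image_def Pi_iff)
  have "winding_number (c \<circ> (a +++ b)) 0 = winding_number (c \<circ> a) 0 + winding_number (c \<circ> b) 0"
    unfolding path_compose_join
    using A B based_loopsD(3)[of a X p] based_loopsD(2)[of b X p]
    by (intro winding_number_join *) (auto simp: pathstart_def pathfinish_def)
  then have "complex_of_int (winding_class c (loop_class X p (a +++ b)))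
      = of_int (winding_class c A + winding_class c B)"
    using A B c by (simp add: winding_class_loop_class based_loops_join)
  then show "winding_class c (A \<otimes>\<^bsub>fundamental_group X p\<^esub> B)
      = winding_class c A \<otimes>\<^bsub>integer_group\<^esub> winding_class c B"
    using A B by (simp add: mult_fundamental_group del: of_int_add)
qed simp

section \<open>The torus action on embeddings\<close>

text \<open>The map is defined on the whole ambient space, where it is real-linear; this makes it
  applicable to derivatives as well as to points.\<close>

definition torus_act :: "complex \<Rightarrow> complex \<Rightarrow> complex \<times> complex \<times> real \<Rightarrow> complex \<times> complex \<times> real" where
  "torus_act a b = (\<lambda>(z, w, s). (a * z, b * w, s))"

lemma torus_act_conv: "torus_act a b x = (a * fst x, b * fst (snd x), snd (snd x))"
  by (simp add: torus_act_def split: prod.split)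

lemma bounded_linear_torus_act: "bounded_linear (torus_act a b)"
  unfolding torus_act_conv
  by (intro bounded_linear_Pair bounded_linear_const_mult bounded_linear_fst_comp
      bounded_linear_snd_comp bounded_linear_fst bounded_linear_snd bounded_linear_ident)

lemma norm_torus_act: "norm a = 1 \<Longrightarrow> norm b = 1 \<Longrightarrow> norm (torus_act a b x) = norm x"
  by (cases x) (simp add: torus_act_def norm_Pair norm_mult)

lemma dist_torus_act:
  assumes "norm a = 1" "norm b = 1"
  shows "dist (torus_act a b x) (torus_act a b y) = dist x y"
  using norm_torus_act[OF assms, of "x - y"] bounded_linear_torus_act[of a b]
  by (simp add: dist_norm linear_diff bounded_linear.linear)

text \<open>Controls a change of the rotation itself. The factor \<open>norm x\<close> will be
  bounded by the maximum of a derivative, which makes the estimate uniform over the circle.\<close>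

lemma dist_torus_act_left:
  "dist (torus_act a b x) (torus_act c d x) \<le> (dist a c + dist b d) * norm x"
proof -
  have "torus_act a b x - torus_act c d x = ((a - c) * fst x, (b - d) * fst (snd x), 0)"
    by (simp add: torus_act_conv algebra_simps)
  then have "dist (torus_act a b x) (torus_act c d x)
      \<le> norm ((a - c) * fst x) + norm ((b - d) * fst (snd x))"
    using norm_Pair_le[of "(a - c) * fst x" "((b - d) * fst (snd x), 0::real)"]
      norm_Pair_le[of "(b - d) * fst (snd x)" "0::real"]
    by (simp add: dist_norm)
  also have "\<dots> \<le> dist a c * norm x + dist b d * norm x"
    using norm_fst_le[of "fst x" "snd x"] norm_snd_le[of "snd x" "fst x"]
      norm_fst_le[of "fst (snd x)" "snd (snd x)"]
    by (intro add_mono) (auto simp: norm_mult dist_norm intro!: mult_left_mono)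
  finally show ?thesis by (simp add: distrib_right)
qed

lemma torus_act_1: "torus_act 1 1 = id"
  by (auto simp: torus_act_def)

lemma torus_act_inverse:
  assumes "norm a = 1" "norm b = 1"
  shows "torus_act (cnj a) (cnj b) (torus_act a b x) = x"
proof -
  have "cnj a * a = 1" "cnj b * b = 1"
    using assms complex_norm_square[of a] complex_norm_square[of b] by (simp_all add: mult.commute)
  then show ?thesis by (simp add: torus_act_conv mult.assoc[symmetric])
qed

lemma torus_act_image:
  assumes "norm a = 1" "norm b = 1" "x \<in> thickened_torus"
  shows "torus_act a b x \<in> thickened_torus"
  using assms by (auto simp: torus_act_def norm_mult)

lemma homeomorphic_map_torus_act:
  assumes "norm a = 1" "norm b = 1"
  shows "homeomorphic_map (top_of_set thickened_torus) (top_of_set thickened_torus) (torus_act a b)"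
  unfolding homeomorphic_map_maps homeomorphic_maps_def
proof (intro exI[of _ "torus_act (cnj a) (cnj b)"] conjI)
  have c: "continuous_map (top_of_set thickened_torus) (top_of_set thickened_torus) (torus_act c d)"
    if "norm c = 1" "norm d = 1" for c d
    using linear_continuous_on[OF bounded_linear_torus_act, of thickened_torus c d]
      torus_act_image[OF that] by (simp add: Pi_iff)
  show "continuous_map (top_of_set thickened_torus) (top_of_set thickened_torus) (torus_act a b)"
    "continuous_map (top_of_set thickened_torus) (top_of_set thickened_torus) (torus_act (cnj a) (cnj b))"
    using assms by (simp_all only: c complex_mod_cnj)
qed (use assms torus_act_inverse[of a b] torus_act_inverse[of "cnj a" "cnj b"] in auto)

section \<open>Angular derivatives and their behaviour under rotation\<close>

lemma circle_deriv_0: "circle_deriv 0 f t = f (cis t)"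
  by (simp add: circle_deriv_def)

lemma circle_deriv_Suc: "circle_deriv (Suc k) f t = vector_derivative (circle_deriv k f) (at t)"
  by (simp add: circle_deriv_def)

lemma smooth_embeddings_deriv:
  assumes "f \<in> smooth_embeddings"
  shows "(circle_deriv k f has_vector_derivative circle_deriv (Suc k) f t) (at t)"
  using assms by (simp add: smooth_embeddings_def circle_deriv_Suc vector_derivative_works)

lemma continuous_on_circle_deriv:
  assumes "f \<in> smooth_embeddings"
  shows "continuous_on S (circle_deriv k f)"
  using smooth_embeddings_deriv[OF assms]
  by (meson continuous_at_imp_continuous_on has_vector_derivative_continuous)

lemma circle_deriv_periodic:
  assumes "f \<in> smooth_embeddings"
  shows "circle_deriv k f (t + 2 * pi) = circle_deriv k f t"
proof (induction k arbitrary: t)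
  case 0
  show ?case by (simp add: circle_deriv_0 flip: cis_mult)
next
  case (Suc k)
  have "((circle_deriv k f \<circ> (\<lambda>t. t + 2 * pi)) has_vector_derivative
      1 *\<^sub>R circle_deriv (Suc k) f (t + 2 * pi)) (at t)"
    by (rule vector_diff_chain_at) (auto intro!: derivative_eq_intros smooth_embeddings_deriv[OF assms])
  then have "(circle_deriv k f has_vector_derivative circle_deriv (Suc k) f (t + 2 * pi)) (at t)"
    by (simp add: o_def Suc.IH)
  then show ?case
    using smooth_embeddings_deriv[OF assms] vector_derivative_unique_at by blast
qed

text \<open>Compactness of the circle, expressed for functions on its universal cover: every point
  is moved into one compact period.\<close>

lemma periodic_attains_max:
  fixes \<phi> :: "real \<Rightarrow> real"
  assumes c: "continuous_on UNIV \<phi>" and per: "\<And>t. \<phi> (t + 2 * pi) = \<phi> t"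
  obtains s where "\<And>t. \<phi> t \<le> \<phi> s"
proof -
  have "\<exists>s\<in>{0..2 * pi}. \<forall>t\<in>{0..2 * pi}. \<phi> t \<le> \<phi> s"
    by (rule continuous_attains_sup) (auto intro: continuous_on_subset[OF c])
  then obtain s where s: "\<And>t. t \<in> {0..2 * pi} \<Longrightarrow> \<phi> t \<le> \<phi> s" by blast
  have nat: "\<phi> (t + 2 * pi * real n) = \<phi> t" for t n
    by (induction n) (use per[of "t + 2 * pi * real _"] in \<open>auto simp: algebra_simps\<close>)
  have int: "\<phi> (t + 2 * pi * of_int i) = \<phi> t" for t i
    using nat[of t "nat i"] nat[of "t + 2 * pi * of_int i" "nat (- i)"]
    by (cases "i \<ge> 0") (auto simp: algebra_simps)
  have "\<phi> t \<le> \<phi> s" for t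
  proof -
    define i where "i = \<lfloor>t / (2 * pi)\<rfloor>"
    have "of_int i \<le> t / (2 * pi)" "t / (2 * pi) < of_int i + 1" unfolding i_def by linarith+
    then have "t + 2 * pi * of_int (- i) \<in> {0..2 * pi}" by (auto simp: field_simps)
    from s[OF this] show ?thesis by (simp only: int)
  qed
  then show ?thesis by (rule that)
qed

text \<open>A bounded linear map commutes with differentiation, so induction on the order
  applies.\<close>

lemma circle_deriv_torus_act:
  assumes "f \<in> smooth_embeddings"
  shows "circle_deriv k (compose circle (torus_act a b) f) t = torus_act a b (circle_deriv k f t)"
proof (induction k arbitrary: t)
  case 0
  show ?case by (simp add: circle_deriv_0 compose_def)
next
  case (Suc k)
  have "circle_deriv k (compose circle (torus_act a b) f) = (\<lambda>t. torus_act a b (circle_deriv k f t))"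
    using Suc by blast
  then show ?case
    using bounded_linear.has_vector_derivative[OF bounded_linear_torus_act smooth_embeddings_deriv[OF assms]]
    by (simp add: circle_deriv_Suc[of k "compose circle (torus_act a b) f"] vector_derivative_at)
qed

lemma smooth_embeddings_torus_act:
  assumes f: "f \<in> smooth_embeddings" and ab: "norm a = 1" "norm b = 1"
  shows "compose circle (torus_act a b) f \<in> smooth_embeddings"
proof -
  let ?g = "compose circle (torus_act a b) f"
  have "f x \<in> thickened_torus" if "x \<in> circle" for x
    using f that unfolding smooth_embeddings_def by blast
  then have "?g \<in> circle \<rightarrow>\<^sub>E thickened_torus"
    unfolding compose_def
    by (intro PiE_I) (simp_all only: restrict_apply if_True if_False torus_act_image[OF ab])
  moreover have "circle_deriv k ?g differentiable (at t)" for k t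
    using bounded_linear.has_vector_derivative[OF bounded_linear_torus_act smooth_embeddings_deriv[OF f]]
    unfolding circle_deriv_torus_act[OF f] by (rule differentiableI_vector)
  \<comment> \<open>The rotation preserves norms, so it cannot annihilate a nonzero
    velocity.\<close>
  moreover have "circle_deriv 1 ?g t \<noteq> 0" for t
    using f norm_torus_act[OF ab, of "circle_deriv 1 f t"]
    by (auto simp: circle_deriv_torus_act smooth_embeddings_def)
  moreover have "embedding_map (top_of_set circle) (top_of_set thickened_torus) ?g"
  proof (rule embedding_map_eq[OF embedding_map_compose])
    show "embedding_map (top_of_set circle) (top_of_set thickened_torus) f"
      using f by (simp add: smooth_embeddings_def)
    show "embedding_map (top_of_set thickened_torus) (top_of_set thickened_torus) (torus_act a b)"
      using homeomorphic_map_torus_act[OF ab] homeomorphic_imp_surjective_map[OF homeomorphic_map_torus_act[OF ab]]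
      by (simp add: embedding_map_def subtopology_subtopology)
  qed (simp add: compose_def)
  ultimately show ?thesis by (simp add: smooth_embeddings_def)
qed

section \<open>Continuity in the C-infinity topology\<close>

lemma openin_Emb_basic:
  assumes "f \<in> smooth_embeddings" "0 < \<epsilon>"
  shows "openin Emb {g \<in> smooth_embeddings. \<forall>t. dist (circle_deriv k g t) (circle_deriv k f t) < \<epsilon>}"
  unfolding Emb_def using assms by (intro topology_generated_by_Basis) blast

text \<open>It suffices to test preimages of the generating sets. The distance to the centre
  \<open>f\<close> is split into three: replacing the nearby knot by \<open>g\<close>, moving the
  rotation back to \<open>(a, b)\<close>, and the distance already present at
  \<open>g\<close>.\<close>

lemma continuous_map_torus_act:
  "continuous_map (prod_topology (top_of_set (circle \<times> circle)) Emb) Emb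
    (\<lambda>((a, b), g). compose circle (torus_act a b) g)"
proof -
  let ?T = "prod_topology (top_of_set (circle \<times> circle)) Emb"
  let ?\<phi> = "\<lambda>((a, b), g). compose circle (torus_act a b) g"
  define B where "B = {{g \<in> smooth_embeddings. \<forall>t. dist (circle_deriv k g t) (circle_deriv k f t) < \<epsilon>} | f k \<epsilon>.
        f \<in> smooth_embeddings \<and> 0 < \<epsilon>}"
  have Emb: "Emb = topology_generated_by B" by (simp add: Emb_def B_def)
  have top: "topspace ?T = (circle \<times> circle) \<times> smooth_embeddings" by (simp add: topspace_Emb)
  have "continuous_map ?T (topology_generated_by B) ?\<phi>"
  proof (rule continuous_on_generated_topo)
    show "?\<phi> ` topspace ?T \<subseteq> \<Union> B"
      using smooth_embeddings_torus_act topspace_Emb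
      unfolding Emb topology_generated_by_topspace by (auto simp: top[unfolded Emb])
    fix W assume "W \<in> B"
    then obtain f k \<epsilon> where f: "f \<in> smooth_embeddings" and \<epsilon>: "0 < \<epsilon>"
      and W: "W = {g \<in> smooth_embeddings. \<forall>t. dist (circle_deriv k g t) (circle_deriv k f t) < \<epsilon>}"
      by (auto simp: B_def)
    show "openin ?T (?\<phi> -` W \<inter> topspace ?T)"
      unfolding openin_prod_topology_alt
    proof (intro allI impI)
      fix c g assume cg: "(c, g) \<in> ?\<phi> -` W \<inter> topspace ?T"
      obtain a b where c: "c = (a, b)" by (cases c)
      have g: "g \<in> smooth_embeddings" and ab: "norm a = 1" "norm b = 1"
        and gW: "\<And>t. dist (torus_act a b (circle_deriv k g t)) (circle_deriv k f t) < \<epsilon>"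
        using cg unfolding top by (auto simp: c W circle_deriv_torus_act)
      have cont: "continuous_on UNIV (\<lambda>t. torus_act a b (circle_deriv k g t))"
        by (rule bounded_linear.continuous_on[OF bounded_linear_torus_act continuous_on_circle_deriv[OF g]])
      \<comment> \<open>Since the maximum over the circle is attained, the pointwise bound by \<open>\<epsilon>\<close> leaves a uniform gap.\<close>
      obtain s where s: "\<And>t. dist (torus_act a b (circle_deriv k g t)) (circle_deriv k f t)
          \<le> dist (torus_act a b (circle_deriv k g s)) (circle_deriv k f s)"
        by (rule periodic_attains_max[where \<phi> = "\<lambda>t. dist (torus_act a b (circle_deriv k g t)) (circle_deriv k f t)"])
          (auto intro!: continuous_on_dist cont continuous_on_circle_deriv f simp: circle_deriv_periodic f g)
      obtain r where r: "\<And>t. norm (circle_deriv k g t) \<le> norm (circle_deriv k g r)"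
        by (rule periodic_attains_max[where \<phi> = "\<lambda>t. norm (circle_deriv k g t)"])
          (auto intro!: continuous_on_norm continuous_on_circle_deriv g simp: circle_deriv_periodic g)
      define M where "M = norm (circle_deriv k g r)"
      define \<epsilon>0 where "\<epsilon>0 = dist (torus_act a b (circle_deriv k g s)) (circle_deriv k f s)"
      \<comment> \<open>One third of the gap pays for the change of knot and one third for each of
        the two rotation parameters. The \<open>1 +\<close> in \<open>\<rho>\<close> keeps the
        denominator positive when \<open>M\<close> is 0.\<close>
      define \<delta> where "\<delta> = (\<epsilon> - \<epsilon>0) / 3"
      define \<rho> where "\<rho> = \<delta> / (1 + M)"
      have M: "M \<ge> 0" and \<delta>: "\<delta> > 0" using gW[of s] by (simp_all add: M_def \<delta>_def \<epsilon>0_def)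
      then have \<rho>: "\<rho> > 0" and \<rho>M: "\<rho> * M \<le> \<delta>" by (simp_all add: \<rho>_def field_simps)
      let ?U = "(circle \<times> circle) \<inter> (ball a \<rho> \<times> ball b \<rho>)"
      let ?V = "{h \<in> smooth_embeddings. \<forall>t. dist (circle_deriv k h t) (circle_deriv k g t) < \<delta>}"
      have "openin (top_of_set (circle \<times> circle)) ?U"
        by (intro openin_open_Int open_Times open_ball)
      moreover have "openin Emb ?V" by (rule openin_Emb_basic[OF g \<delta>])
      moreover have "c \<in> ?U" "g \<in> ?V" using ab g \<rho> \<delta> by (auto simp: c)
      moreover have "((a', b'), h) \<in> ?\<phi> -` W \<inter> topspace ?T" if "((a', b'), h) \<in> ?U \<times> ?V" for a' b' h
      proof -
        have a'b': "(a', b') \<in> circle \<times> circle" "a' \<in> ball a \<rho>" "b' \<in> ball b \<rho>"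
          and h: "h \<in> smooth_embeddings" "\<forall>t. dist (circle_deriv k h t) (circle_deriv k g t) < \<delta>"
          using that by blast+
        have n: "norm a' = 1" "norm b' = 1" using a'b' by auto
        have "dist (torus_act a' b' (circle_deriv k h t)) (circle_deriv k f t) < \<epsilon>" for t
        proof -
          let ?h = "circle_deriv k h t" and ?g = "circle_deriv k g t" and ?f = "circle_deriv k f t"
          have 1: "dist (torus_act a' b' ?h) (torus_act a' b' ?g) < \<delta>"
            using h by (simp add: dist_torus_act[OF n])
          have "dist (torus_act a' b' ?g) (torus_act a b ?g) \<le> (dist a' a + dist b' b) * norm ?g"
            by (rule dist_torus_act_left)
          also have "\<dots> \<le> (\<rho> + \<rho>) * M"
            using a'b' r[of t] \<rho> by (intro mult_mono add_mono) (auto simp: M_def dist_commute)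
          also have "\<dots> \<le> 2 * \<delta>" using \<rho>M by (simp add: algebra_simps)
          finally have 2: "dist (torus_act a' b' ?g) (torus_act a b ?g) \<le> 2 * \<delta>" .
          have 3: "dist (torus_act a b ?g) ?f \<le> \<epsilon>0" using s by (simp add: \<epsilon>0_def)
          have "dist (torus_act a' b' ?h) ?f < \<delta> + 2 * \<delta> + \<epsilon>0"
            using 1 2 3 dist_triangle[of "torus_act a' b' ?h" ?f "torus_act a' b' ?g"]
              dist_triangle[of "torus_act a' b' ?g" ?f "torus_act a b ?g"] by linarith
          moreover have "3 * \<delta> = \<epsilon> - \<epsilon>0" by (simp add: \<delta>_def)
          ultimately show ?thesis by linarith
        qed
        then show ?thesis
          using n h(1) smooth_embeddings_torus_act[OF h(1) n]
          unfolding top by (simp add: W circle_deriv_torus_act)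
      qed
      then have "?U \<times> ?V \<subseteq> ?\<phi> -` W \<inter> topspace ?T"
        unfolding subset_iff split_paired_All by blast
      ultimately show "\<exists>U V. openin (top_of_set (circle \<times> circle)) U \<and> openin Emb V \<and> c \<in> U \<and> g \<in> V
          \<and> U \<times> V \<subseteq> ?\<phi> -` W \<inter> topspace ?T"
        by blast
    qed
  qed
  then show ?thesis by (simp only: Emb)
qed

text \<open>The point \<open>1\<close> is \<open>cis 0\<close>, so closeness of the derivatives of
  order 0 at the angle 0 is enough.\<close>

lemma continuous_map_Emb_eval: "continuous_map Emb euclidean (\<lambda>g. g 1)"
  unfolding continuous_map_def
proof (intro conjI allI impI)
  fix U :: "(complex \<times> complex \<times> real) set" assume "openin euclidean U"
  then have U: "open U" by (simp only: open_openin)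
  show "openin Emb {g \<in> topspace Emb. g 1 \<in> U}"
  proof (subst openin_subopen, intro ballI)
    fix g assume "g \<in> {g \<in> topspace Emb. g 1 \<in> U}"
    then have g: "g \<in> smooth_embeddings" "g 1 \<in> U" by (auto simp: topspace_Emb)
    then obtain \<epsilon> where \<epsilon>: "\<epsilon> > 0" "\<And>y. dist y (g 1) < \<epsilon> \<Longrightarrow> y \<in> U"
      using U by (auto simp: open_dist)
    let ?V = "{h \<in> smooth_embeddings. \<forall>t. dist (circle_deriv 0 h t) (circle_deriv 0 g t) < \<epsilon>}"
    have "openin Emb ?V" by (rule openin_Emb_basic[OF g(1) \<epsilon>(1)])
    moreover have "g \<in> ?V" using g \<epsilon> by simp
    moreover have "h 1 \<in> U" if "h \<in> ?V" for h
    proof -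
      have "dist (circle_deriv 0 h 0) (circle_deriv 0 g 0) < \<epsilon>" using that by blast
      then show ?thesis by (intro \<epsilon>(2)) (simp add: circle_deriv_0)
    qed
    ultimately show "\<exists>V. openin Emb V \<and> g \<in> V \<and> V \<subseteq> {g \<in> topspace Emb. g 1 \<in> U}"
      unfolding topspace_Emb by (intro exI[of _ ?V]) auto
  qed
qed auto

text \<open>Beyond continuity, the component must be preserved: rotating gradually joins each knot
  to its rotated copy. The two speeds \<open>\<alpha>\<close> and \<open>\<beta>\<close> cover both
  rotation loops at once.\<close>

lemma continuous_map_knot_component_rotation:
  "continuous_map (prod_topology (top_of_set {0..1}) (knot_component f)) (knot_component f)
    (\<lambda>(t, g). compose circle (torus_act (cis (\<alpha> * t)) (cis (\<beta> * t))) g)"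
proof -
  let ?I = "top_of_set {0..1::real}" and ?C = "path_component_of_set Emb f"
  let ?R = "\<lambda>(t, g). compose circle (torus_act (cis (\<alpha> * t)) (cis (\<beta> * t))) g"
  have "continuous_map (prod_topology ?I Emb) (prod_topology (top_of_set (circle \<times> circle)) Emb)
      (\<lambda>(t, g). ((cis (\<alpha> * t), cis (\<beta> * t)), g))"
    unfolding continuous_map_prod_top[of ?I Emb _ _ "\<lambda>t. (cis (\<alpha> * t), cis (\<beta> * t))" id, simplified]
    by (auto intro!: continuous_intros)
  from continuous_map_compose[OF this continuous_map_torus_act]
  have R: "continuous_map (prod_topology ?I Emb) Emb ?R"
    by (simp add: o_def case_prod_unfold)
  have "?R (t, g) \<in> ?C" if "t \<in> {0..1}" "g \<in> ?C" for t g
  proof -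
    from that have "path_component_of Emb f g" by simp
    moreover then have g: "g \<in> smooth_embeddings"
      using path_component_of_equiv[of Emb f g] by (simp add: topspace_Emb)
    \<comment> \<open>Rescaling time by \<open>t\<close> turns the rotation up to time
      \<open>t\<close> into a path over the whole unit interval.\<close>
    then have "continuous_map ?I (prod_topology ?I Emb) (\<lambda>s. (s * t, g))"
      using that by (intro continuous_map_pairedI) (auto intro!: continuous_intros mult_le_one simp: topspace_Emb)
    from continuous_map_compose[OF this R] have "pathin Emb (\<lambda>s. ?R (s * t, g))"
      by (simp add: pathin_def o_def)
    then have "path_component_of Emb (?R (0 * t, g)) (?R (1 * t, g))"
      unfolding path_component_of_def by blast
    moreover have "?R (0 * t, g) = g"
      using g by (auto simp: torus_act_1 smooth_embeddings_def compose_def extensional_restrict PiE_def)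
    ultimately show ?thesis using path_component_of_trans by fastforce
  qed
  moreover have "continuous_map (prod_topology ?I (knot_component f)) Emb ?R"
    unfolding knot_component_def prod_topology_subtopology(2)
    by (intro continuous_map_from_subtopology) (rule R)
  ultimately show ?thesis
    by (subst (2) knot_component_def)
      (auto intro!: continuous_map_into_subtopology simp: knot_component_def topspace_subtopology)
qed

section \<open>The direct factor\<close>

theorem corollary8p6:
  fixes f :: "complex \<Rightarrow> complex \<times> complex \<times> real"
  assumes "f \<in> smooth_embeddings"
  defines "G \<equiv> fundamental_group (knot_component f) f"
  defines "H \<equiv> generate G {mu1_lambda2 f, lambda1_mu2 f}"
  shows "subgroup H G \<and>
    subgroup_generated G H \<cong> integer_group \<times>\<times> integer_group \<and>
    (\<exists>K. subgroup K G \<and>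
      (\<lambda>(x, y). x \<otimes>\<^bsub>G\<^esub> y) \<in> iso (subgroup_generated G H \<times>\<times> subgroup_generated G K) G)"
proof -
  let ?X = "knot_component f"
  have f1: "f 1 \<in> thickened_torus"
    using assms(1) unfolding smooth_embeddings_def by (intro PiE_mem[of f circle]) auto
  then have n1: "norm (fst (f 1)) = 1" "norm (fst (snd (f 1))) = 1" by auto
  have "path_component_of Emb f f"
    using assms(1) by (simp add: path_component_of_refl topspace_Emb)
  then have fX: "f \<in> topspace ?X"
    using assms(1) by (simp add: knot_component_def topspace_Emb)
  have X: "g \<in> smooth_embeddings" if "g \<in> topspace ?X" for g
    using that by (simp add: knot_component_def topspace_Emb)
  interpret G: group G
    unfolding G_def by (rule group_fundamental_group[OF fX])
  \<comment> \<open>The speed 0 in one factor exhibits each rotation as an instance of the two-speed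
    family.\<close>
  have rot: "rotate_first t = torus_act (cis (2 * pi * t)) (cis (0 * t))"
    "rotate_second t = torus_act (cis (0 * t)) (cis (2 * pi * t))" for t
    by (auto simp: rotate_first_def rotate_second_def torus_act_def)
  have id: "compose circle id g = g" if "g \<in> topspace ?X" for g
    using X[OF that] by (auto simp: smooth_embeddings_def compose_def extensional_restrict PiE_def)
  have first: "continuous_map (prod_topology (top_of_set {0..1}) ?X) ?X
      (\<lambda>(t, g). compose circle (rotate_first t) g)"
    and second: "continuous_map (prod_topology (top_of_set {0..1}) ?X) ?X
      (\<lambda>(t, g). compose circle (rotate_second t) g)"
    unfolding rot by (rule continuous_map_knot_component_rotation)+
  have ends: "rotate_first 0 = id" "rotate_first 1 = id" "rotate_second 0 = id" "rotate_second 1 = id"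
    by (auto simp: rot torus_act_1)
  note orbit1 = orbit_loop_central[OF first _ _ fX, unfolded ends, OF id id]
  note orbit2 = orbit_loop_central[OF second _ _ fX, unfolded ends, OF id id]
  \<comment> \<open>The orbit lemma is stated relative to some element of the group; the unit serves
    to extract its first conclusion.\<close>
  have loops: "(\<lambda>t. compose circle (rotate_first t) f) \<in> based_loops ?X f"
    "(\<lambda>t. compose circle (rotate_second t) f) \<in> based_loops ?X f"
    using orbit1(1) orbit2(1) G.one_closed unfolding G_def by blast+
  \<comment> \<open>Dividing by the coordinate of \<open>f 1\<close> makes the rotation loops go
    exactly to the standard circle or to the constant 1, so their winding numbers can be read
    off.\<close>
  define c where "c = (\<lambda>g :: complex \<Rightarrow> complex \<times> complex \<times> real. fst (g 1) / fst (f 1))"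
  define d where "d = (\<lambda>g :: complex \<Rightarrow> complex \<times> complex \<times> real. fst (snd (g 1)) / fst (snd (f 1)))"
  have ev: "continuous_map ?X euclidean (\<lambda>g. g 1)"
    unfolding knot_component_def by (intro continuous_map_from_subtopology continuous_map_Emb_eval)
  have g1: "fst (g 1) \<noteq> 0" "fst (snd (g 1)) \<noteq> 0" if "g \<in> topspace ?X" for g
  proof -
    have "g 1 \<in> thickened_torus"
      using X[OF that] unfolding smooth_embeddings_def by (intro PiE_mem[of g circle]) auto
    then show "fst (g 1) \<noteq> 0" "fst (snd (g 1)) \<noteq> 0" by auto
  qed
  have "continuous_map euclidean euclidean (\<lambda>x::complex \<times> complex \<times> real. fst x / fst (f 1))"
    "continuous_map euclidean euclidean (\<lambda>x::complex \<times> complex \<times> real. fst (snd x) / fst (snd (f 1)))"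
    using n1 by (auto intro!: continuous_intros)
  from this[THEN continuous_map_compose[OF ev]]
  have c: "continuous_map ?X (top_of_set (- {0})) c" and d: "continuous_map ?X (top_of_set (- {0})) d"
    using n1 g1 by (auto intro!: continuous_map_into_subtopology simp: o_def c_def d_def)
  have circ: "winding_number (\<lambda>t. cis (2 * pi * t)) 0 = 1"
    using winding_number_circlepath_centre[of 1 0]
    by (simp add: circlepath cis_conv_exp mult_ac)
  have const: "winding_number (\<lambda>t. 1) (0::complex) = 0"
    using winding_number_zero_const[of "1::complex" 0] by (simp add: linepath_def)
  have "c \<circ> (\<lambda>t. compose circle (rotate_first t) f) = (\<lambda>t. cis (2 * pi * t))"
    "c \<circ> (\<lambda>t. compose circle (rotate_second t) f) = (\<lambda>t. 1)"
    "d \<circ> (\<lambda>t. compose circle (rotate_first t) f) = (\<lambda>t. 1)"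
    "d \<circ> (\<lambda>t. compose circle (rotate_second t) f) = (\<lambda>t. cis (2 * pi * t))"
    using n1 by (auto simp: c_def d_def compose_def rot torus_act_conv o_def fun_eq_iff)
  with loops circ const
  have wind: "winding_class c (lambda1_mu2 f) = 1" "winding_class c (mu1_lambda2 f) = 0"
    "winding_class d (lambda1_mu2 f) = 0" "winding_class d (mu1_lambda2 f) = 1"
    unfolding lambda1_mu2_def mu1_lambda2_def
    using winding_class_loop_class[OF c, of _ f] winding_class_loop_class[OF d, of _ f]
    by (metis of_int_0_eq_iff of_int_eq_1_iff)+
  show ?thesis
    unfolding H_def
  proof (rule G.central_direct_factor)
    show "mu1_lambda2 f \<in> carrier G" "lambda1_mu2 f \<in> carrier G"
      using loops by (simp_all add: G_def carrier_fundamental_group mu1_lambda2_def lambda1_mu2_def quotientI)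
    show "mu1_lambda2 f \<otimes>\<^bsub>G\<^esub> x = x \<otimes>\<^bsub>G\<^esub> mu1_lambda2 f" if "x \<in> carrier G" for x
      using orbit2(2) that unfolding G_def mu1_lambda2_def by blast
    show "lambda1_mu2 f \<otimes>\<^bsub>G\<^esub> x = x \<otimes>\<^bsub>G\<^esub> lambda1_mu2 f" if "x \<in> carrier G" for x
      using orbit1(2) that unfolding G_def lambda1_mu2_def by blast
    \<comment> \<open>The first generator rotates the second factor, so the winding of
      \<open>d\<close> is paired with it and the winding of \<open>c\<close> with the other.\<close>
    show "winding_class d \<in> hom G integer_group" "winding_class c \<in> hom G integer_group"
      unfolding G_def by (rule winding_class_hom[OF d] winding_class_hom[OF c])+
  qed (rule wind)+
qed

end
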